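(* Let $G$ be a connected graph such that the relation $\mathcal{C}_G$ has exactly three equivalence classes. If $G$ is not complete tripartite, then there exists an edge $e\in E(G)$ such that $V(S_e)=V(G)$, where $S_e$ denotes the equivalence class of $e$ under $\mathcal{C}_G$.
   Context: A quasi-transitive $2$-edge-colouring of a graph $G$ is a map $c: E(G)\to\{R,B\}$ such that for all pairs of edges $xy, yz \in E(G)$ with $c(xy)\neq c(yz)$, we have $xz\in E(G)$. $\mathcal{C}_G$ is the equivalence relation on $E(G)$ with $e\sim f$ iff $c(e)=c(f)$ for every quasi-transitive $2$-edge-colouring $c$ of $G$. For a set of edges $E$, $V(E)$ denotes the set of endpoints of edges in $E$. *)

theory Defs
  imports Main
begin

text \<open>A graph is given by its vertex set \<open>V\<close> (finite or infinite) and its set \<open>E\<close> of edges,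
  the edge \<open>xy\<close> being the two-element set \<open>{x, y}\<close>. For a set \<open>S\<close> of edges, the set of endpoints
  is \<open>\<Union>S\<close>.\<close>

definition simple_graph :: "'a set \<Rightarrow> 'a set set \<Rightarrow> bool" where
  "simple_graph V E \<longleftrightarrow> (\<forall>e\<in>E. e \<subseteq> V \<and> card e = 2)"

definition connected_graph :: "'a set \<Rightarrow> 'a set set \<Rightarrow> bool" where
  "connected_graph V E \<longleftrightarrow>
     V \<noteq> {} \<and> (\<forall>u\<in>V. \<forall>v\<in>V. (\<lambda>x y. {x, y} \<in> E)\<^sup>*\<^sup>* u v)"

definition complete_tripartite :: "'a set \<Rightarrow> 'a set set \<Rightarrow> bool" where
  "complete_tripartite V E \<longleftrightarrow>
     (\<exists>X Y Z. X \<noteq> {} \<and> Y \<noteq> {} \<and> Z \<noteq> {} \<and>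
        X \<inter> Y = {} \<and> X \<inter> Z = {} \<and> Y \<inter> Z = {} \<and> V = X \<union> Y \<union> Z \<and>
        E = {{x, y} | x y. (x, y) \<in> X \<times> Y \<union> X \<times> Z \<union> Y \<times> Z})"

datatype colour = Red | Blue

text \<open>A colouring is a total function on sets of vertices, but only its values on \<open>E\<close> matter,
  here and in \<open>colour_rel\<close>.\<close>

definition quasi_transitive_colouring :: "'a set set \<Rightarrow> ('a set \<Rightarrow> colour) \<Rightarrow> bool" where
  "quasi_transitive_colouring E c \<longleftrightarrow>
     (\<forall>x y z. {x, y} \<in> E \<longrightarrow> {y, z} \<in> E \<longrightarrow> c {x, y} \<noteq> c {y, z} \<longrightarrow> {x, z} \<in> E)"

definition colour_rel :: "'a set set \<Rightarrow> ('a set \<times> 'a set) set" where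
  "colour_rel E =
     {(e, f). e \<in> E \<and> f \<in> E \<and> (\<forall>c. quasi_transitive_colouring E c \<longrightarrow> c e = c f)}"

lemma equiv_colour_rel: "equiv E (colour_rel E)"
  by (rule equivI) (auto simp: colour_rel_def refl_on_def sym_def trans_def)

end

theory Submission
  imports Defs
begin

text \<open>A colouring is quasi-transitive iff any two edges forming an induced path on three vertices
  get the same colour, so the classes are the components of the edges under this relation. Walking
  along such paths inside a class \<open>S\<close> shows that a vertex \<open>v \<notin> \<Union>S\<close> with a neighbour in \<open>\<Union>S\<close> is
  joined to all of \<open>\<Union>S\<close>, and that if it is joined to both ends of one edge of \<open>S\<close> by edges of the
  same class \<open>T\<close>, then it is joined to all of \<open>\<Union>S\<close> by edges of \<open>T\<close>.

  Let \<open>A\<close>, \<open>B\<close>, \<open>C\<close> be the classes and suppose that none of them spans \<open>V\<close>. If, say, \<open>\<Union>C \<subseteq> \<Union>A\<close>,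
  then a vertex outside \<open>\<Union>A\<close> with a neighbour in \<open>\<Union>A\<close> has only \<open>B\<close>-edges, so that
  \<open>\<Union>A \<subseteq> \<Union>B\<close> and \<open>B\<close> spans. Hence there are no such inclusions. Then every vertex
  misses at most one of the three classes, the vertices missing a given class are joined to all
  vertices not missing it, and they form an independent set. A vertex missing no class would
  contradict the second fact above, so the three sets of vertices missing a class exhibit the graph
  as complete tripartite.\<close>

section \<open>Edge classes and induced paths\<close>

lemma mem_class_if_induced_path:
  assumes "S \<in> E // colour_rel E" "{x, y} \<in> S" "{y, z} \<in> E" "{x, z} \<notin> E"
  shows "{y, z} \<in> S"
proof -
  obtain e where S: "S = colour_rel E `` {e}"
    using assms(1) by (auto elim: quotientE)
  then have e: "e \<in> E" "\<And>c. quasi_transitive_colouring E c \<Longrightarrow> c e = c {x, y}" "{x, y} \<in> E"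
    using assms(2) unfolding colour_rel_def by auto
  have "c e = c {y, z}" if "quasi_transitive_colouring E c" for c
    using that assms(3,4) e(2)[OF that] e(3) unfolding quasi_transitive_colouring_def by metis
  then show ?thesis
    using S e(1) assms(3) unfolding colour_rel_def by simp
qed

lemma class_subset:
  "S \<in> E // colour_rel E \<Longrightarrow> S \<subseteq> E"
  by (auto elim!: quotientE simp: colour_rel_def)

lemma class_nonempty:
  "S \<in> E // colour_rel E \<Longrightarrow> S \<noteq> {}"
  using equiv_colour_rel in_quotient_imp_non_empty by blast

text \<open>An induction principle for classes: colouring the members of \<open>S\<close> with
  property \<open>P\<close> red and all other edges blue is quasi-transitive, because membership in
  \<open>S\<close> and \<open>P\<close> both pass along induced paths in either direction. Hence
  this colouring cannot separate \<open>e\<close> from \<open>f\<close>.\<close>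

lemma class_connected_by_induced_paths:
  assumes S: "S \<in> E // colour_rel E"
    and e: "e \<in> S" "P e" and f: "f \<in> S"
    and step: "\<And>x y z. {x, y} \<in> S \<Longrightarrow> {y, z} \<in> S \<Longrightarrow> {x, z} \<notin> E \<Longrightarrow> P {x, y} \<Longrightarrow> P {y, z}"
  shows "P f"
proof -
  define c where "c g = (if g \<in> S \<and> P g then Red else Blue)" for g
  have "c {x, y} = c {y, z}" if "{x, y} \<in> E" "{y, z} \<in> E" "{x, z} \<notin> E" for x y z
  proof -
    have iff: "{x, y} \<in> S \<longleftrightarrow> {y, z} \<in> S"
      using that mem_class_if_induced_path[OF S, of x y z]
        mem_class_if_induced_path[OF S, of z y x] by (auto simp: insert_commute)
    then show ?thesis
      using that step[of x y z] step[of z y x] by (auto simp: c_def insert_commute)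
  qed
  then have "quasi_transitive_colouring E c"
    unfolding quasi_transitive_colouring_def by blast
  moreover have "(e, f) \<in> colour_rel E"
    using S e(1) f equiv_colour_rel quotient_eq_iff by metis
  ultimately have "c e = c f"
    unfolding colour_rel_def by blast
  then show ?thesis
    using e f by (auto simp: c_def split: if_splits)
qed

section \<open>Vertices outside a class\<close>

locale sgraph =
  fixes V :: "'a set" and E :: "'a set set"
  assumes simple: "simple_graph V E"
begin

lemma class_verts_subset: "S \<in> E // colour_rel E \<Longrightarrow> \<Union>S \<subseteq> V"
  using simple class_subset unfolding simple_graph_def by blast

lemma edge_at_vertex:
  assumes "S \<in> E // colour_rel E" "x \<in> \<Union>S"
  obtains y where "{x, y} \<in> S"
proof -
  obtain e where e: "e \<in> S" "x \<in> e" using assms(2) by blast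
  then have "card e = 2"
    using simple class_subset[OF assms(1)] unfolding simple_graph_def by blast
  with e show ?thesis
    using that by (auto simp: card_2_iff insert_commute)
qed

lemma pair_in_class:
  assumes "S \<in> E // colour_rel E"
  obtains x y where "{x, y} \<in> S"
proof -
  obtain e where "e \<in> S" using class_nonempty[OF assms] by blast
  moreover from this have "card e = 2"
    using simple class_subset[OF assms] unfolding simple_graph_def by blast
  ultimately show ?thesis using that by (auto simp: card_2_iff)
qed

lemma outside_vertex_complete_to_class:
  assumes S: "S \<in> E // colour_rel E"
    and v: "v \<notin> \<Union>S" and x: "x \<in> \<Union>S" "{v, x} \<in> E" and u: "u \<in> \<Union>S"
  shows "{v, u} \<in> E"
proof -
  have adj: "{v, b} \<in> E" if "{a, b} \<in> S" "{v, a} \<in> E" for a b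
  proof (rule ccontr)
    \<comment> \<open>Then \<open>b\<close>, \<open>a\<close>, \<open>v\<close> is an induced path,
      which forces its edge at \<open>v\<close> into \<open>S\<close>.\<close>
    assume "{v, b} \<notin> E"
    then have "{a, v} \<in> S"
      using mem_class_if_induced_path[OF S, of b a v] that by (auto simp: insert_commute)
    with v show False by blast
  qed
  obtain y where y: "{x, y} \<in> S" using edge_at_vertex[OF S x(1)] .
  obtain w where w: "{u, w} \<in> S" using edge_at_vertex[OF S u] .
  have "\<forall>a\<in>{u, w}. {v, a} \<in> E"
    by (rule class_connected_by_induced_paths[OF S y _ w, where P = "\<lambda>e. \<forall>a\<in>e. {v, a} \<in> E"])
      (use adj x(2) y in auto)
  then show ?thesis by simp
qed

lemma outside_vertex_monochromatic:
  assumes S: "S \<in> E // colour_rel E" and T: "T \<in> E // colour_rel E"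
    and v: "v \<notin> \<Union>S" and xy: "{x, y} \<in> S" "{v, x} \<in> T" "{v, y} \<in> T" and u: "u \<in> \<Union>S"
  shows "{v, u} \<in> T"
proof -
  have E: "{v, a} \<in> E" if "a \<in> \<Union>S" for a
    by (rule outside_vertex_complete_to_class[OF S v _ _ that, of x])
      (use xy class_subset[OF T] in auto)
  obtain w where w: "{u, w} \<in> S" using edge_at_vertex[OF S u] .
  have "\<forall>a\<in>{u, w}. {v, a} \<in> T"
  proof (rule class_connected_by_induced_paths[OF S xy(1) _ w, where P = "\<lambda>e. \<forall>a\<in>e. {v, a} \<in> T"])
    show "\<forall>a\<in>{x, y}. {v, a} \<in> T" using xy by simp
    fix a b c
    assume *: "{a, b} \<in> S" "{b, c} \<in> S" "{a, c} \<notin> E" "\<forall>a\<in>{a, b}. {v, a} \<in> T"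
    have "{v, c} \<in> E" using E * by blast
    \<comment> \<open>Now \<open>a\<close>, \<open>v\<close>, \<open>c\<close> is an induced path as
      well, so \<open>{v, c}\<close> inherits the class \<open>T\<close> of
      \<open>{v, a}\<close>.\<close>
    then have "{v, c} \<in> T"
      using mem_class_if_induced_path[OF T, of a v c] * by (auto simp: insert_commute)
    then show "\<forall>a\<in>{b, c}. {v, a} \<in> T" using * by simp
  qed
  then show ?thesis by simp
qed

text \<open>If both edges from \<open>v\<close> lay in \<open>T\<close>, then \<open>T\<close> would
  cover all endpoints of \<open>S\<close>, against the assumed non-inclusion.\<close>

lemma outside_vertex_bichromatic:
  assumes "S \<in> E // colour_rel E" "T \<in> E // colour_rel E" "\<not> \<Union>S \<subseteq> \<Union>T"
    and "v \<notin> \<Union>S" "{x, y} \<in> S" "{v, x} \<in> T"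
  shows "{v, y} \<notin> T"
  using outside_vertex_monochromatic[OF assms(1,2,4,5,6)] assms(3) by blast

end

section \<open>Consequences of connectedness\<close>

locale connected_sgraph = sgraph +
  assumes conn: "connected_graph V E"
begin

lemma boundary_edge:
  assumes "W \<subseteq> V" "W \<noteq> V" "W \<noteq> {}"
  obtains v x where "v \<in> V" "v \<notin> W" "x \<in> W" "{v, x} \<in> E"
proof -
  obtain a b where ab: "a \<in> W" "b \<in> V" "b \<notin> W" using assms by blast
  then have "(\<lambda>x y. {x, y} \<in> E)\<^sup>*\<^sup>* a b"
    using conn assms(1) unfolding connected_graph_def by blast
  then have "\<exists>v x. v \<notin> W \<and> x \<in> W \<and> {v, x} \<in> E"
    using ab(3)
  proof (induction rule: rtranclp_induct)
    case base
    then show ?case using ab(1) by simp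
  next
    case (step y z)
    \<comment> \<open>Either \<open>y\<close> is in \<open>W\<close> and \<open>{y, z}\<close> is
      the crossing edge, or the induction hypothesis applies.\<close>
    then show ?case using insert_commute[of y z "{}"] by metis
  qed
  then show ?thesis
    using that simple unfolding simple_graph_def by blast
qed

lemma vertex_adjacent_to_class:
  assumes S: "S \<in> E // colour_rel E" "\<Union>S \<noteq> V"
  obtains v where "v \<in> V" "v \<notin> \<Union>S" "\<And>x. x \<in> \<Union>S \<Longrightarrow> {v, x} \<in> E"
proof -
  have "\<Union>S \<noteq> {}" using pair_in_class[OF S(1)] by blast
  then obtain v x where "v \<in> V" "v \<notin> \<Union>S" "x \<in> \<Union>S" "{v, x} \<in> E"
    using boundary_edge[OF class_verts_subset[OF S(1)] S(2)] by blast
  then show ?thesis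
    using that outside_vertex_complete_to_class[OF S(1)] by blast
qed

lemma vertex_in_some_edge:
  assumes "S \<in> E // colour_rel E" "a \<in> V"
  shows "a \<in> \<Union>E"
proof -
  obtain x y where "{x, y} \<in> S" using pair_in_class[OF assms(1)] .
  then have "{x, y} \<in> E" using class_subset[OF assms(1)] by blast
  then have "x \<in> V" "y \<in> V" "x \<noteq> y"
    using simple unfolding simple_graph_def by force+
  then have "{a} \<noteq> V" by blast
  then show ?thesis
    using boundary_edge[of "{a}"] assms(2) by blast
qed

lemma spanning_if_nested:
  assumes cl: "A \<in> E // colour_rel E" "B \<in> E // colour_rel E"
    and E: "E = A \<union> B \<union> C" and sub: "\<Union>C \<subseteq> \<Union>A" and ne: "\<Union>A \<noteq> V"
  shows "\<Union>B = V"
proof -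
  obtain v where v: "v \<in> V" "v \<notin> \<Union>A" "\<And>x. x \<in> \<Union>A \<Longrightarrow> {v, x} \<in> E"
    using vertex_adjacent_to_class[OF cl(1) ne] by blast
  have "\<Union>A \<subseteq> \<Union>B"
  proof
    fix x assume "x \<in> \<Union>A"
    then have "{v, x} \<in> B" using v E sub by blast
    then show "x \<in> \<Union>B" by blast
  qed
  moreover have "V \<subseteq> \<Union>E" using vertex_in_some_edge[OF cl(1)] by blast
  ultimately have "V \<subseteq> \<Union>B" using E sub by blast
  then show ?thesis using class_verts_subset[OF cl(2)] by blast
qed

end

section \<open>Three classes, none of them spanning\<close>

locale three_nonspanning_classes = connected_sgraph +
  fixes A B C :: "'a set set"
  assumes classes: "A \<in> E // colour_rel E" "B \<in> E // colour_rel E" "C \<in> E // colour_rel E"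
    and E_eq: "E = A \<union> B \<union> C"
    and nonspanning: "\<Union>A \<noteq> V" "\<Union>B \<noteq> V" "\<Union>C \<noteq> V"
begin

text \<open>Together with \<open>swap\<close> this generates all permutations of the classes, so
  each fact below is proved for one arrangement only.\<close>

lemma rotate: "three_nonspanning_classes V E B C A"
  by unfold_locales (use classes E_eq nonspanning in auto)

lemma swap: "three_nonspanning_classes V E A C B"
  by unfold_locales (use classes E_eq nonspanning in auto)

lemma not_nested: "\<not> \<Union>A \<subseteq> \<Union>B"
  using spanning_if_nested[of B C A] classes E_eq nonspanning by blast

lemma mem_other_if_outside:
  assumes v: "v \<notin> \<Union>A" "v \<in> \<Union>B"
  shows "v \<in> \<Union>C"
proof -
  obtain w where "w \<notin> \<Union>B" "{w, v} \<in> E"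
    using vertex_adjacent_to_class[OF classes(2) nonspanning(2)] v(2) by blast
  \<comment> \<open>This edge is not in \<open>B\<close> because of \<open>w\<close>, and not in
    \<open>A\<close> because of \<open>v\<close>.\<close>
  then have "{w, v} \<in> C" using E_eq v by blast
  then show ?thesis by blast
qed

lemma mem_others_if_outside:
  assumes "v \<in> V" "v \<notin> \<Union>A"
  shows "v \<in> \<Union>B" "v \<in> \<Union>C"
  using vertex_in_some_edge[OF classes(1) assms(1)] assms(2) E_eq mem_other_if_outside
    three_nonspanning_classes.mem_other_if_outside[OF swap] by blast+

lemma outside_complete:
  assumes v: "v \<in> V" "v \<notin> \<Union>A" and u: "u \<in> \<Union>A"
  shows "{v, u} \<in> E"
proof -
  obtain w where w: "w \<in> V" "w \<notin> \<Union>B" "{w, v} \<in> E"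
    using vertex_adjacent_to_class[OF classes(2) nonspanning(2)] mem_others_if_outside(1)[OF v]
    by blast
  interpret r: three_nonspanning_classes V E B C A by (rule rotate)
  \<comment> \<open>So \<open>v\<close> has a neighbour in \<open>\<Union>A\<close>, from which
    adjacency spreads to \<open>u\<close>.\<close>
  have "w \<in> \<Union>A" using r.mem_others_if_outside w by blast
  then show ?thesis
    using outside_vertex_complete_to_class[OF classes(1) v(2) _ _ u] w(3)
    by (auto simp: insert_commute)
qed

lemma edge_between_outsides:
  assumes "p \<in> V" "p \<notin> \<Union>A" "q \<in> V" "q \<notin> \<Union>B"
  shows "{p, q} \<in> C"
proof -
  interpret r: three_nonspanning_classes V E B C A by (rule rotate)
  have "q \<in> \<Union>A" using r.mem_others_if_outside assms by blast
  then have "{p, q} \<in> E" using outside_complete assms by blast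
  then show ?thesis using assms E_eq by blast
qed

text \<open>Vertices \<open>p\<close>, \<open>q\<close>, \<open>r\<close> missing \<open>A\<close>,
  \<open>B\<close>, \<open>C\<close> respectively form a triangle with one edge in each class. A
  \<open>B\<close>-edge from \<open>p\<close> to \<open>t\<close> forces \<open>{r, t}\<close> into
  \<open>B\<close>, and then \<open>{q, t}\<close> is left without a class.\<close>

lemma no_B_edge_to_common_vertex:
  assumes p: "p \<in> V" "p \<notin> \<Union>A" and t: "t \<in> \<Union>A" "t \<in> \<Union>B" "t \<in> \<Union>C"
  shows "{p, t} \<notin> B"
proof
  assume pt: "{p, t} \<in> B"
  interpret r: three_nonspanning_classes V E B C A by (rule rotate)
  interpret rr: three_nonspanning_classes V E C A B by (rule r.rotate)
  interpret s: three_nonspanning_classes V E A C B by (rule swap)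
  interpret rs: three_nonspanning_classes V E B A C by (rule r.swap)
  obtain q where q: "q \<in> V" "q \<notin> \<Union>B" using nonspanning class_verts_subset[OF classes(2)] by blast
  obtain r where r: "r \<in> V" "r \<notin> \<Union>C" using nonspanning class_verts_subset[OF classes(3)] by blast
  have pq: "{q, p} \<in> C" and pr: "{p, r} \<in> B" and qr: "{q, r} \<in> A"
    using edge_between_outsides p q r s.edge_between_outsides r.edge_between_outsides
    by (auto simp: insert_commute)
  \<comment> \<open>Otherwise \<open>p\<close> would send \<open>B\<close>-edges to both ends of an
    edge of \<open>A\<close>.\<close>
  have "{r, t} \<notin> A"
    using outside_vertex_bichromatic[OF classes(1,2) not_nested p(2) _ pr] pt by blast
  moreover have "{r, t} \<in> E" using rr.outside_complete r t by blast
  ultimately have rt: "{r, t} \<in> B" using E_eq r by blast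
  \<comment> \<open>The \<open>B\<close>-edges \<open>{r, t}\<close> and \<open>{p, t}\<close>, seen
    from \<open>q\<close>, exclude \<open>A\<close> and \<open>C\<close> in turn.\<close>
  have "{q, t} \<notin> A"
    using outside_vertex_bichromatic[OF classes(2,1) rs.not_nested q(2) rt qr] .
  moreover have "{q, t} \<notin> C"
    using outside_vertex_bichromatic[OF classes(2,3) r.not_nested q(2) pt pq] .
  moreover have "{q, t} \<in> E" using r.outside_complete q t by blast
  ultimately show False using E_eq q by blast
qed

lemma no_common_vertex: "\<Union>A \<inter> \<Union>B \<inter> \<Union>C = {}"
proof (rule ccontr)
  assume "\<Union>A \<inter> \<Union>B \<inter> \<Union>C \<noteq> {}"
  then obtain t where t: "t \<in> \<Union>A" "t \<in> \<Union>B" "t \<in> \<Union>C" by blast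
  interpret s: three_nonspanning_classes V E A C B by (rule swap)
  obtain p where p: "p \<in> V" "p \<notin> \<Union>A" using nonspanning class_verts_subset[OF classes(1)] by blast
  have "{p, t} \<in> E" using outside_complete p t by blast
  then show False
    using no_B_edge_to_common_vertex[OF p t] s.no_B_edge_to_common_vertex[OF p t(1,3,2)] E_eq p(2)
    by blast
qed

text \<open>A vertex \<open>q\<close> missing \<open>B\<close> would send \<open>C\<close>-edges to
  both ends of the \<open>B\<close>-edge \<open>{p, p'}\<close>.\<close>

lemma no_B_edge_outside_A:
  assumes p: "p \<in> V" "p \<notin> \<Union>A" and p': "p' \<in> V" "p' \<notin> \<Union>A"
  shows "{p, p'} \<notin> B"
proof
  assume pp: "{p, p'} \<in> B"
  interpret r: three_nonspanning_classes V E B C A by (rule rotate)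
  obtain q where q: "q \<in> V" "q \<notin> \<Union>B" using nonspanning class_verts_subset[OF classes(2)] by blast
  have "{q, p} \<in> C" "{q, p'} \<in> C"
    using edge_between_outsides p p' q by (auto simp: insert_commute)
  then show False
    using outside_vertex_bichromatic[OF classes(2,3) r.not_nested q(2) pp] by blast
qed

lemma outside_independent:
  assumes p: "p \<in> V" "p \<notin> \<Union>A" and p': "p' \<in> V" "p' \<notin> \<Union>A"
  shows "{p, p'} \<notin> E"
proof -
  interpret s: three_nonspanning_classes V E A C B by (rule swap)
  show ?thesis
    using no_B_edge_outside_A[OF p p'] s.no_B_edge_outside_A[OF p p'] p E_eq by blast
qed

lemma complete_tripartite: "complete_tripartite V E"
proof -
  interpret r: three_nonspanning_classes V E B C A by (rule rotate)
  interpret rr: three_nonspanning_classes V E C A B by (rule r.rotate)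
  interpret s: three_nonspanning_classes V E A C B by (rule swap)
  define X Y Z where "X = V - \<Union>A" and "Y = V - \<Union>B" and "Z = V - \<Union>C"
  have ne: "X \<noteq> {}" "Y \<noteq> {}" "Z \<noteq> {}"
    using nonspanning classes class_verts_subset unfolding X_def Y_def Z_def by blast+
  have disj: "X \<inter> Y = {}" "X \<inter> Z = {}" "Y \<inter> Z = {}"
    using mem_others_if_outside r.mem_others_if_outside unfolding X_def Y_def Z_def by blast+
  have V: "V = X \<union> Y \<union> Z"
    using no_common_vertex unfolding X_def Y_def Z_def by blast
  have join: "{x, y} \<in> E" if "(x, y) \<in> X \<times> Y \<union> X \<times> Z \<union> Y \<times> Z" for x y
    using that edge_between_outsides s.edge_between_outsides r.edge_between_outsides E_eq
    unfolding X_def Y_def Z_def by blast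
  have indep: "{x, y} \<notin> E" if "x \<in> X \<and> y \<in> X \<or> x \<in> Y \<and> y \<in> Y \<or> x \<in> Z \<and> y \<in> Z" for x y
    using that outside_independent r.outside_independent rr.outside_independent
    unfolding X_def Y_def Z_def by blast
  have "E = {{x, y} | x y. (x, y) \<in> X \<times> Y \<union> X \<times> Z \<union> Y \<times> Z}" (is "_ = ?J")
  proof
    show "?J \<subseteq> E" using join by blast
    show "E \<subseteq> ?J"
    proof
      fix e assume e: "e \<in> E"
      then obtain x y where xy: "e = {x, y}" "x \<in> V" "y \<in> V"
        using simple unfolding simple_graph_def by (fastforce simp: card_2_iff)
      then have "(x, y) \<in> X \<times> Y \<union> X \<times> Z \<union> Y \<times> Z \<or> (y, x) \<in> X \<times> Y \<union> X \<times> Z \<union> Y \<times> Z"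
        using e V indep[of x y] by blast
      then show "e \<in> ?J" using xy(1) insert_commute[of x y "{}"] by blast
    qed
  qed
  with ne disj V show ?thesis unfolding complete_tripartite_def by blast
qed

end

theorem theorem28:
  fixes V :: "'a set" and E :: "'a set set"
  assumes "simple_graph V E"
    and "connected_graph V E"
    and "card (E // colour_rel E) = 3"
    and "\<not> complete_tripartite V E"
  shows "\<exists>e\<in>E. \<Union>(colour_rel E `` {e}) = V"
proof (rule ccontr)
  assume "\<not> ?thesis"
  then have nonspanning: "\<Union>S \<noteq> V" if "S \<in> E // colour_rel E" for S
    using that by (auto elim!: quotientE)
  obtain A B C where cl: "E // colour_rel E = {A, B, C}"
    using assms(3) by (auto simp: card_3_iff)
  have "E = A \<union> B \<union> C"
    using Union_quotient[OF equiv_colour_rel, of E] cl by auto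
  then have "three_nonspanning_classes V E A B C"
    by unfold_locales (use assms cl nonspanning in auto)
  then show False
    using three_nonspanning_classes.complete_tripartite assms(4) by blast
qed

end
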